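(* Let $A$ be a finite $1$-bounded pointed residuated join-semilattice whose constant $0$ is its bottom element, and write $-x=0/x$ and ${\sim}x=x\backslash 0$. Then $A$ (with the operations ${\sim},-$) is an involutive semiring if and only if $A$ and $\mathrm{Id}(A)$ are isomorphic as $A$-semimodules via the map $\Phi:A\to\mathrm{Id}(A)$, $\Phi(a)={\downarrow}{-}a=\{x\in A\mid x\le -a\}$ (i.e., $\Phi$ is an isomorphism of $A$-semimodules).
   Context: A residuated join-semilattice is an algebra $(A,\vee,\cdot,1,\backslash,/)$ such that $(A,\vee)$ is a join-semilattice with order $x\le y\iff x\vee y=y$, $(A,\cdot,1)$ is a monoid, and $xy\le z\iff x\le z/y\iff y\le x\backslash z$ for all $x,y,z$. It is pointed if equipped with an additional constant $0$, and $1$-bounded if $1$ is the top element. When $0$ is the bottom element, $(A,\vee,0,\cdot,1)$ is an additively idempotent semiring. $A$ is an involutive semiring if $(A,\vee)$ is a join-semilattice, $(A,\cdot,1)$ is a monoid with $\cdot$ distributing over $\vee$ on both sides, and for all $x,y\in A$, $x\le y\iff x\cdot{\sim}y\le -1\iff -y\cdot x\le -1$. A (left) semimodule over a semiring $A$ is a commutative monoid $(M,+,0)$ with scalar multiplication $A\times M\to M$ satisfying $(ab)\cdot x=a\cdot(b\cdot x)$, $a\cdot(x+y)=a\cdot x+a\cdot y$, $(a+b)\cdot x=a\cdot x+b\cdot x$, $0_A\cdot x=0_M=a\cdot 0_M$, $1\cdot x=x$. $A$ is regarded as a semimodule over itself with addition $\vee$ and $a\cdot x=ax$. $\mathrm{Id}(A)$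 is the set of ideals of the join-semilattice $(A,\vee,0)$, i.e. nonempty subsets $I\subseteq A$ closed under $\vee$ and downward closed; it is an $A$-semimodule with addition $I\cap J$ (ordered by reverse inclusion), zero $A$, and scalar multiplication $a\cdot I=\{x\in A\mid xa\in I\}$. *)

theory Defs
  imports "HOL-Algebra.Module"
begin

text \<open>
  The join of a residuated join-semilattice and its constant \<open>0\<close> are the fields \<open>add\<close> and
  \<open>zero\<close> of the underlying ring record, so that \<open>semiring\<close> from HOL-Algebra can be applied to it.
  The residual \<open>lres A x y\<close> is ``x under y'' (written with a backslash) and \<open>rres A x y\<close> is
  \<open>x / y\<close>, with the arguments in infix order.
\<close>

record 'a residuated = "'a ring" +
  lres :: "'a \<Rightarrow> 'a \<Rightarrow> 'a"
  rres :: "'a \<Rightarrow> 'a \<Rightarrow> 'a"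

definition jle :: "('a, 'm) ring_scheme \<Rightarrow> 'a \<Rightarrow> 'a \<Rightarrow> bool" (infixl "\<preceq>\<index>" 50)
  where "x \<preceq>\<^bsub>A\<^esub> y \<longleftrightarrow> x \<oplus>\<^bsub>A\<^esub> y = y"

locale join_semilattice =
  fixes A (structure)
  assumes join_closed: "\<lbrakk>x \<in> carrier A; y \<in> carrier A\<rbrakk> \<Longrightarrow> x \<oplus> y \<in> carrier A"
    and join_assoc: "\<lbrakk>x \<in> carrier A; y \<in> carrier A; z \<in> carrier A\<rbrakk>
      \<Longrightarrow> (x \<oplus> y) \<oplus> z = x \<oplus> (y \<oplus> z)"
    and join_comm: "\<lbrakk>x \<in> carrier A; y \<in> carrier A\<rbrakk> \<Longrightarrow> x \<oplus> y = y \<oplus> x"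
    and join_idem: "x \<in> carrier A \<Longrightarrow> x \<oplus> x = x"

locale residuated_join_semilattice = join_semilattice A + monoid A
  for A (structure) +
  assumes lres_closed: "\<lbrakk>x \<in> carrier A; y \<in> carrier A\<rbrakk> \<Longrightarrow> lres A x y \<in> carrier A"
    and rres_closed: "\<lbrakk>x \<in> carrier A; y \<in> carrier A\<rbrakk> \<Longrightarrow> rres A x y \<in> carrier A"
    and rres_iff: "\<lbrakk>x \<in> carrier A; y \<in> carrier A; z \<in> carrier A\<rbrakk>
      \<Longrightarrow> x \<otimes> y \<preceq> z \<longleftrightarrow> x \<preceq> rres A z y"
    and lres_iff: "\<lbrakk>x \<in> carrier A; y \<in> carrier A; z \<in> carrier A\<rbrakk>
      \<Longrightarrow> x \<otimes> y \<preceq> z \<longleftrightarrow> y \<preceq> lres A x z"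

locale pointed_residuated_join_semilattice = residuated_join_semilattice A
  for A (structure) +
  assumes point_closed: "\<zero> \<in> carrier A"

definition is_top :: "('a, 'm) ring_scheme \<Rightarrow> 'a \<Rightarrow> bool"
  where "is_top A t \<longleftrightarrow> t \<in> carrier A \<and> (\<forall>x \<in> carrier A. x \<preceq>\<^bsub>A\<^esub> t)"

definition is_bottom :: "('a, 'm) ring_scheme \<Rightarrow> 'a \<Rightarrow> bool"
  where "is_bottom A b \<longleftrightarrow> b \<in> carrier A \<and> (\<forall>x \<in> carrier A. b \<preceq>\<^bsub>A\<^esub> x)"

definition one_bounded :: "('a, 'm) ring_scheme \<Rightarrow> bool"
  where "one_bounded A \<longleftrightarrow> is_top A \<one>\<^bsub>A\<^esub>"

definition lneg :: "('a, 'm) residuated_scheme \<Rightarrow> 'a \<Rightarrow> 'a"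
  where "lneg A x = rres A \<zero>\<^bsub>A\<^esub> x"

definition rneg :: "('a, 'm) residuated_scheme \<Rightarrow> 'a \<Rightarrow> 'a"
  where "rneg A x = lres A x \<zero>\<^bsub>A\<^esub>"

text \<open>The parameters \<open>sim\<close> and \<open>neg\<close> are the unary operations written as a tilde and a minus sign.\<close>

locale involutive_semiring = join_semilattice A + monoid A
  for A (structure) and sim :: "'a \<Rightarrow> 'a" and neg :: "'a \<Rightarrow> 'a" +
  assumes sim_closed: "x \<in> carrier A \<Longrightarrow> sim x \<in> carrier A"
    and neg_closed: "x \<in> carrier A \<Longrightarrow> neg x \<in> carrier A"
    and join_mult_distrib: "\<lbrakk>x \<in> carrier A; y \<in> carrier A; z \<in> carrier A\<rbrakk>
      \<Longrightarrow> (x \<oplus> y) \<otimes> z = (x \<otimes> z) \<oplus> (y \<otimes> z)"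
    and mult_join_distrib: "\<lbrakk>x \<in> carrier A; y \<in> carrier A; z \<in> carrier A\<rbrakk>
      \<Longrightarrow> x \<otimes> (y \<oplus> z) = (x \<otimes> y) \<oplus> (x \<otimes> z)"
    and le_iff_sim: "\<lbrakk>x \<in> carrier A; y \<in> carrier A\<rbrakk>
      \<Longrightarrow> x \<preceq> y \<longleftrightarrow> x \<otimes> sim y \<preceq> neg \<one>"
    and le_iff_neg: "\<lbrakk>x \<in> carrier A; y \<in> carrier A\<rbrakk>
      \<Longrightarrow> x \<preceq> y \<longleftrightarrow> neg y \<otimes> x \<preceq> neg \<one>"

text \<open>
  As for modules in HOL-Algebra, semimodules are records of type \<open>module\<close>; the fields \<open>mult\<close> and
  \<open>one\<close> that these inherit play no role.
\<close>

locale semimodule = R: semiring R + M: abelian_monoid M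
  for R :: "('a, 'm) ring_scheme" (structure) and M :: "('a, 'b, 'n) module_scheme" (structure) +
  assumes smult_closed: "\<lbrakk>a \<in> carrier R; x \<in> carrier M\<rbrakk> \<Longrightarrow> a \<odot>\<^bsub>M\<^esub> x \<in> carrier M"
    and smult_assoc: "\<lbrakk>a \<in> carrier R; b \<in> carrier R; x \<in> carrier M\<rbrakk>
      \<Longrightarrow> (a \<otimes> b) \<odot>\<^bsub>M\<^esub> x = a \<odot>\<^bsub>M\<^esub> (b \<odot>\<^bsub>M\<^esub> x)"
    and smult_add_right: "\<lbrakk>a \<in> carrier R; x \<in> carrier M; y \<in> carrier M\<rbrakk>
      \<Longrightarrow> a \<odot>\<^bsub>M\<^esub> (x \<oplus>\<^bsub>M\<^esub> y) = a \<odot>\<^bsub>M\<^esub> x \<oplus>\<^bsub>M\<^esub> a \<odot>\<^bsub>M\<^esub> y"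
    and smult_add_left: "\<lbrakk>a \<in> carrier R; b \<in> carrier R; x \<in> carrier M\<rbrakk>
      \<Longrightarrow> (a \<oplus> b) \<odot>\<^bsub>M\<^esub> x = a \<odot>\<^bsub>M\<^esub> x \<oplus>\<^bsub>M\<^esub> b \<odot>\<^bsub>M\<^esub> x"
    and zero_smult: "x \<in> carrier M \<Longrightarrow> \<zero> \<odot>\<^bsub>M\<^esub> x = \<zero>\<^bsub>M\<^esub>"
    and smult_zero: "a \<in> carrier R \<Longrightarrow> a \<odot>\<^bsub>M\<^esub> \<zero>\<^bsub>M\<^esub> = \<zero>\<^bsub>M\<^esub>"
    and one_smult: "x \<in> carrier M \<Longrightarrow> \<one> \<odot>\<^bsub>M\<^esub> x = x"

locale semimodule_iso = M: semimodule R M + N: semimodule R N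
  for R :: "('a, 'm) ring_scheme" and M :: "('a, 'b, 'n) module_scheme"
    and N :: "('a, 'c, 'k) module_scheme" and f :: "'b \<Rightarrow> 'c" +
  assumes map_add: "\<lbrakk>x \<in> carrier M; y \<in> carrier M\<rbrakk> \<Longrightarrow> f (x \<oplus>\<^bsub>M\<^esub> y) = f x \<oplus>\<^bsub>N\<^esub> f y"
    and map_zero: "f \<zero>\<^bsub>M\<^esub> = \<zero>\<^bsub>N\<^esub>"
    and map_smult: "\<lbrakk>a \<in> carrier R; x \<in> carrier M\<rbrakk> \<Longrightarrow> f (a \<odot>\<^bsub>M\<^esub> x) = a \<odot>\<^bsub>N\<^esub> f x"
    and map_bij: "bij_betw f (carrier M) (carrier N)"

definition self_semimodule :: "('a, 'm) ring_scheme \<Rightarrow> ('a, 'a) module"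
  where "self_semimodule A =
    \<lparr>carrier = carrier A, mult = mult A, one = one A, zero = zero A, add = add A, smult = mult A\<rparr>"

definition join_ideals :: "('a, 'm) ring_scheme \<Rightarrow> 'a set set"
  where "join_ideals A = {I. I \<subseteq> carrier A \<and> I \<noteq> {} \<and>
    (\<forall>x \<in> I. \<forall>y \<in> I. x \<oplus>\<^bsub>A\<^esub> y \<in> I) \<and>
    (\<forall>y \<in> I. \<forall>x \<in> carrier A. x \<preceq>\<^bsub>A\<^esub> y \<longrightarrow> x \<in> I)}"

definition ideal_semimodule :: "('a, 'm) ring_scheme \<Rightarrow> ('a, 'a set) module"
  where "ideal_semimodule A =
    \<lparr>carrier = join_ideals A, mult = undefined, one = undefined,
     zero = carrier A, add = (\<inter>),
     smult = (\<lambda>a I. {x \<in> carrier A. x \<otimes>\<^bsub>A\<^esub> a \<in> I})\<rparr>"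

definition down_neg :: "('a, 'm) residuated_scheme \<Rightarrow> 'a \<Rightarrow> 'a set"
  where "down_neg A a = {x \<in> carrier A. x \<preceq>\<^bsub>A\<^esub> lneg A a}"

end

(* Membership x \<in> down_neg A a means x \<otimes> a = \<zero>, from which the semimodule laws for ideals and the
   linearity of down_neg A follow in every case. Both sides of the equivalence therefore say that
   the two negations are mutually inverse: since -(\<sim>(-a)) = -a always holds, injectivity gives
   \<sim>(-a) = a, and surjectivity gives -(\<sim>a) = a because, A being finite, every ideal is principal. *)

theory Submission
  imports Defs
begin

section \<open>Order, ideals and finite bounds in a join-semilattice\<close>

context join_semilattice
begin

lemma le_refl: "x \<in> carrier A \<Longrightarrow> x \<preceq> x"
  by (simp add: jle_def join_idem)

lemma le_antisym: "\<lbrakk>x \<in> carrier A; y \<in> carrier A; x \<preceq> y; y \<preceq> x\<rbrakk> \<Longrightarrow> x = y"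
  by (metis jle_def join_comm)

lemma le_trans:
  "\<lbrakk>x \<in> carrier A; y \<in> carrier A; z \<in> carrier A; x \<preceq> y; y \<preceq> z\<rbrakk> \<Longrightarrow> x \<preceq> z"
  by (metis jle_def join_assoc)

lemma le_join_left: "\<lbrakk>x \<in> carrier A; y \<in> carrier A\<rbrakk> \<Longrightarrow> x \<preceq> x \<oplus> y"
  by (metis jle_def join_assoc join_idem)

lemma le_join_right: "\<lbrakk>x \<in> carrier A; y \<in> carrier A\<rbrakk> \<Longrightarrow> y \<preceq> x \<oplus> y"
  by (metis le_join_left join_comm)

lemma join_le_iff:
  "\<lbrakk>x \<in> carrier A; y \<in> carrier A; z \<in> carrier A\<rbrakk> \<Longrightarrow> x \<oplus> y \<preceq> z \<longleftrightarrow> x \<preceq> z \<and> y \<preceq> z"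
  by (metis jle_def join_assoc join_closed le_join_left le_join_right le_trans)

lemma eq_if_same_lower_bounds:
  assumes "a \<in> carrier A" "b \<in> carrier A" "\<And>x. x \<in> carrier A \<Longrightarrow> x \<preceq> a \<longleftrightarrow> x \<preceq> b"
  shows "a = b"
  using assms le_antisym le_refl by blast

lemma eq_if_same_upper_bounds:
  assumes "a \<in> carrier A" "b \<in> carrier A" "\<And>x. x \<in> carrier A \<Longrightarrow> a \<preceq> x \<longleftrightarrow> b \<preceq> x"
  shows "a = b"
  using assms le_antisym le_refl by blast

lemma principal_join_ideal:
  assumes "a \<in> carrier A"
  shows "{x \<in> carrier A. x \<preceq> a} \<in> join_ideals A"
proof -
  have "\<forall>y \<in> {x \<in> carrier A. x \<preceq> a}. \<forall>x \<in> carrier A. x \<preceq> y \<longrightarrow> x \<preceq> a"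
    using assms le_trans by blast
  then show ?thesis
    using assms le_refl join_closed join_le_iff by (auto simp: join_ideals_def)
qed

text \<open>Keeping \<open>F\<close> apart from \<open>I\<close> lets the induction run over
  \<open>F\<close> while \<open>I\<close> stays fixed; joining each new element to the previous
  bound never leaves \<open>I\<close>.\<close>

lemma finite_bounded_in_join_closed:
  assumes "finite F" "F \<noteq> {}" "F \<subseteq> I" "I \<subseteq> carrier A"
    and "\<And>x y. \<lbrakk>x \<in> I; y \<in> I\<rbrakk> \<Longrightarrow> x \<oplus> y \<in> I"
  shows "\<exists>m \<in> I. \<forall>x \<in> F. x \<preceq> m"
  using assms(1-3)
proof (induction F rule: finite_ne_induct)
  case (singleton x)
  then show ?case
    using assms(4) le_refl by auto
next
  case (insert x F)
  then obtain m where m: "m \<in> I" "\<forall>y \<in> F. y \<preceq> m"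
    by auto
  have c: "x \<in> carrier A" "m \<in> carrier A" "F \<subseteq> carrier A"
    using insert.prems m assms(4) by auto
  then have "\<forall>y \<in> F. y \<preceq> x \<oplus> m"
    using m le_trans le_join_right join_closed by (meson subsetD)
  then show ?case
    using insert.prems m(1) c assms(5) le_join_left by (intro bexI[of _ "x \<oplus> m"]) auto
qed

text \<open>A finite ideal contains an upper bound of itself, hence has a greatest element, and
  downward closure supplies everything below it.\<close>

lemma finite_join_ideal_principal:
  assumes "finite (carrier A)" "I \<in> join_ideals A"
  obtains m where "m \<in> carrier A" "I = {x \<in> carrier A. x \<preceq> m}"
proof -
  have I: "I \<subseteq> carrier A" "I \<noteq> {}" "\<And>x y. \<lbrakk>x \<in> I; y \<in> I\<rbrakk> \<Longrightarrow> x \<oplus> y \<in> I"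
    "\<And>x y. \<lbrakk>y \<in> I; x \<in> carrier A; x \<preceq> y\<rbrakk> \<Longrightarrow> x \<in> I"
    using assms(2) by (auto simp: join_ideals_def)
  obtain m where "m \<in> I" "\<forall>x \<in> I. x \<preceq> m"
    using finite_bounded_in_join_closed[of I I] I finite_subset[OF I(1) assms(1)] by blast
  then show thesis
    using I by (intro that[of m]) auto
qed

end

section \<open>Distributivity from residuation\<close>

context residuated_join_semilattice
begin

text \<open>Right multiplication by \<open>z\<close> is a left adjoint, with right adjoint
  \<open>rres A _ z\<close>, so it preserves joins: both sides have the same upper bounds.\<close>

lemma mult_distrib_right:
  assumes "x \<in> carrier A" "y \<in> carrier A" "z \<in> carrier A"
  shows "(x \<oplus> y) \<otimes> z = (x \<otimes> z) \<oplus> (y \<otimes> z)"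
  using assms
  by (intro eq_if_same_upper_bounds) (simp_all add: join_closed rres_iff rres_closed join_le_iff)

lemma mult_distrib_left:
  assumes "x \<in> carrier A" "y \<in> carrier A" "z \<in> carrier A"
  shows "x \<otimes> (y \<oplus> z) = (x \<otimes> y) \<oplus> (x \<otimes> z)"
  using assms
  by (intro eq_if_same_upper_bounds) (simp_all add: join_closed lres_iff lres_closed join_le_iff)

end

section \<open>The two negations when \<open>\<zero>\<close> is the bottom\<close>

locale bottom_pointed_residuated_join_semilattice = pointed_residuated_join_semilattice +
  assumes point_bottom: "is_bottom A \<zero>"
begin

lemma zero_le: "x \<in> carrier A \<Longrightarrow> \<zero> \<preceq> x"
  using point_bottom by (simp add: is_bottom_def)

lemma le_zero_iff: "x \<in> carrier A \<Longrightarrow> x \<preceq> \<zero> \<longleftrightarrow> x = \<zero>"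
  using zero_le le_antisym point_closed le_refl by blast

lemma mult_zero_left: "x \<in> carrier A \<Longrightarrow> \<zero> \<otimes> x = \<zero>"
  by (metis le_zero_iff m_closed point_closed rres_closed rres_iff zero_le)

lemma mult_zero_right: "x \<in> carrier A \<Longrightarrow> x \<otimes> \<zero> = \<zero>"
  by (metis le_zero_iff m_closed point_closed lres_closed lres_iff zero_le)

lemma lneg_closed: "x \<in> carrier A \<Longrightarrow> lneg A x \<in> carrier A"
  by (simp add: lneg_def rres_closed point_closed)

lemma rneg_closed: "x \<in> carrier A \<Longrightarrow> rneg A x \<in> carrier A"
  by (simp add: rneg_def lres_closed point_closed)

text \<open>Residuation at the bottom turns bounds by a negation into vanishing products. Together
  with \<open>le_rneg_iff\<close> it makes \<open>lneg A\<close> and \<open>rneg A\<close> an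
  antitone Galois connection.\<close>

lemma le_lneg_iff: "\<lbrakk>x \<in> carrier A; y \<in> carrier A\<rbrakk> \<Longrightarrow> x \<preceq> lneg A y \<longleftrightarrow> x \<otimes> y = \<zero>"
  by (metis le_zero_iff lneg_def m_closed point_closed rres_iff)

lemma le_rneg_iff: "\<lbrakk>x \<in> carrier A; y \<in> carrier A\<rbrakk> \<Longrightarrow> y \<preceq> rneg A x \<longleftrightarrow> x \<otimes> y = \<zero>"
  by (metis le_zero_iff lres_iff m_closed point_closed rneg_def)

lemma lneg_one: "lneg A \<one> = \<zero>"
  by (metis le_lneg_iff le_refl lneg_closed one_closed r_one)

text \<open>This is the triple identity of the Galois connection: every value of
  \<open>lneg A\<close> is a closed element.\<close>

lemma lneg_rneg_lneg:
  assumes "a \<in> carrier A"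
  shows "lneg A (rneg A (lneg A a)) = lneg A a"
proof -
  define n where "n = lneg A a"
  define l where "l = lneg A (rneg A n)"
  have c: "n \<in> carrier A" "rneg A n \<in> carrier A" "l \<in> carrier A" "rneg A l \<in> carrier A"
    using assms by (simp_all add: n_def l_def lneg_closed rneg_closed)
  have "l \<otimes> rneg A n = \<zero>"
    using c le_refl[of l] le_lneg_iff[of l "rneg A n"] by (simp add: l_def)
  then have "rneg A n \<preceq> rneg A l"
    using c by (simp add: le_rneg_iff)
  moreover have "n \<otimes> a = \<zero>"
    using c assms le_refl[of n] le_lneg_iff[of n a] by (simp add: n_def)
  then have "a \<preceq> rneg A n"
    using c assms by (simp add: le_rneg_iff)
  \<comment> \<open>Chaining the two bounds amounts to \<open>l \<otimes> a = \<zero>\<close>, that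
    is, to \<open>l \<preceq> lneg A a\<close>.\<close>
  ultimately have "a \<preceq> rneg A l"
    using c assms le_trans by blast
  then have "l \<preceq> n"
    using c assms by (simp add: le_rneg_iff le_lneg_iff n_def)
  moreover have "n \<otimes> rneg A n = \<zero>"
    using c le_refl[of "rneg A n"] le_rneg_iff[of n "rneg A n"] by simp
  then have "n \<preceq> l"
    using c by (simp add: l_def le_lneg_iff)
  ultimately show ?thesis
    using c le_antisym[of l n] by (simp add: l_def n_def)
qed

text \<open>As \<open>lneg A \<one>\<close> is \<open>\<zero>\<close>, the two order axioms for
  \<open>y\<close> say that \<open>x \<preceq> y\<close> is equivalent to
  \<open>x \<preceq> lneg A (rneg A y)\<close> and to \<open>x \<preceq> rneg A (lneg A y)\<close>.
  Elements with the same lower bounds coincide.\<close>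

lemma involutive_semiring_iff:
  "involutive_semiring A (rneg A) (lneg A) \<longleftrightarrow>
    (\<forall>a \<in> carrier A. lneg A (rneg A a) = a \<and> rneg A (lneg A a) = a)"
proof
  assume "involutive_semiring A (rneg A) (lneg A)"
  then interpret I: involutive_semiring A "rneg A" "lneg A" .
  show "\<forall>a \<in> carrier A. lneg A (rneg A a) = a \<and> rneg A (lneg A a) = a"
  proof (intro ballI conjI)
    fix a assume a: "a \<in> carrier A"
    show "lneg A (rneg A a) = a"
      using a by (intro eq_if_same_lower_bounds)
        (simp_all add: lneg_closed rneg_closed le_lneg_iff I.le_iff_sim[of _ a] lneg_one le_zero_iff)
    show "rneg A (lneg A a) = a"
      using a by (intro eq_if_same_lower_bounds)
        (simp_all add: lneg_closed rneg_closed le_rneg_iff I.le_iff_neg[of _ a] lneg_one le_zero_iff)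
  qed
next
  assume inv: "\<forall>a \<in> carrier A. lneg A (rneg A a) = a \<and> rneg A (lneg A a) = a"
  show "involutive_semiring A (rneg A) (lneg A)"
  proof (unfold_locales)
    fix x y assume xy: "x \<in> carrier A" "y \<in> carrier A"
    show "x \<preceq> y \<longleftrightarrow> x \<otimes> rneg A y \<preceq> lneg A \<one>"
      using xy inv le_lneg_iff[of x "rneg A y"] by (simp add: lneg_one le_zero_iff rneg_closed)
    show "x \<preceq> y \<longleftrightarrow> lneg A y \<otimes> x \<preceq> lneg A \<one>"
      using xy inv le_rneg_iff[of "lneg A y" x] by (simp add: lneg_one le_zero_iff lneg_closed)
  qed (simp_all add: lneg_closed rneg_closed mult_distrib_right mult_distrib_left)
qed

section \<open>The semimodules formed by the algebra and by its ideals\<close>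

lemma semiring: "semiring A"
proof -
  have "\<zero> \<oplus> x = x" if "x \<in> carrier A" for x
    using zero_le[OF that] by (simp add: jle_def)
  then have "abelian_monoid A"
    by (intro abelian_monoid.intro comm_monoidI)
      (auto intro: join_closed join_assoc join_comm point_closed)
  then show ?thesis
    using monoid_axioms by (intro semiring.intro semiring_axioms.intro)
      (simp_all add: mult_distrib_right mult_distrib_left mult_zero_left mult_zero_right)
qed

lemma self_semimodule: "semimodule A (self_semimodule A)"
proof -
  interpret S: semiring A by (rule semiring)
  have "abelian_monoid (self_semimodule A)"
    unfolding self_semimodule_def
    by (intro abelian_monoid.intro comm_monoidI) (simp_all add: S.add.m_assoc S.add.m_comm S.add.m_lcomm)
  then show ?thesis
    by (intro semimodule.intro semimodule_axioms.intro semiring)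
      (simp_all add: self_semimodule_def m_assoc S.l_distr S.r_distr)
qed

lemma zero_in_join_ideal: "I \<in> join_ideals A \<Longrightarrow> \<zero> \<in> I"
  using zero_le point_closed by (auto simp: join_ideals_def)

lemma join_in_join_ideal_iff:
  assumes "I \<in> join_ideals A" "x \<in> carrier A" "y \<in> carrier A"
  shows "x \<oplus> y \<in> I \<longleftrightarrow> x \<in> I \<and> y \<in> I"
proof -
  have "\<And>z. \<lbrakk>x \<oplus> y \<in> I; z \<in> carrier A; z \<preceq> x \<oplus> y\<rbrakk> \<Longrightarrow> z \<in> I" "\<lbrakk>x \<in> I; y \<in> I\<rbrakk> \<Longrightarrow> x \<oplus> y \<in> I"
    using assms(1) unfolding join_ideals_def by blast+
  then show ?thesis
    using assms le_join_left le_join_right by blast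
qed

text \<open>Converse to \<open>join_in_join_ideal_iff\<close>. Downward closure is covered because
  \<open>x \<preceq> y\<close> means \<open>x \<oplus> y = y\<close>, so \<open>y \<in> I\<close>
  puts the join, and hence \<open>x\<close>, into \<open>I\<close>.\<close>

lemma join_idealI:
  assumes "I \<subseteq> carrier A" "\<zero> \<in> I"
    and "\<And>x y. \<lbrakk>x \<in> carrier A; y \<in> carrier A\<rbrakk> \<Longrightarrow> x \<oplus> y \<in> I \<longleftrightarrow> x \<in> I \<and> y \<in> I"
  shows "I \<in> join_ideals A"
  unfolding join_ideals_def jle_def using assms by (auto, metis subsetD)

lemma join_ideal_subset: "I \<in> join_ideals A \<Longrightarrow> I \<subseteq> carrier A"
  by (simp add: join_ideals_def)

lemma join_ideal_Int: "\<lbrakk>I \<in> join_ideals A; J \<in> join_ideals A\<rbrakk> \<Longrightarrow> I \<inter> J \<in> join_ideals A"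
  by (intro join_idealI)
    (auto simp: zero_in_join_ideal join_in_join_ideal_iff dest: join_ideal_subset)

lemma carrier_join_ideal: "carrier A \<in> join_ideals A"
  using point_closed join_closed by (auto simp: join_ideals_def)

lemma ideal_semimodule: "semimodule A (ideal_semimodule A)"
proof -
  interpret S: semiring A by (rule semiring)
  have "abelian_monoid (ideal_semimodule A)"
    unfolding ideal_semimodule_def
    by (intro abelian_monoid.intro comm_monoidI)
      (use join_ideal_subset in \<open>auto simp: join_ideal_Int carrier_join_ideal\<close>)
  \<comment> \<open>The scalar multiple is the preimage of \<open>I\<close> under right
    multiplication by \<open>a\<close>, which preserves joins and \<open>\<zero>\<close>.\<close>
  moreover have "{x \<in> carrier A. x \<otimes> a \<in> I} \<in> join_ideals A"
    if "a \<in> carrier A" "I \<in> join_ideals A" for a I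
    using that
    by (intro join_idealI) (auto simp: S.l_distr join_in_join_ideal_iff zero_in_join_ideal)
  ultimately show ?thesis
    by (intro semimodule.intro semimodule_axioms.intro semiring)
      (auto simp: ideal_semimodule_def m_assoc S.r_distr subsetD[OF join_ideal_subset]
        join_in_join_ideal_iff zero_in_join_ideal)
qed

section \<open>The map \<open>down_neg A\<close> as a left annihilator, and its bijectivity\<close>

lemma down_neg_eq: "a \<in> carrier A \<Longrightarrow> down_neg A a = {x \<in> carrier A. x \<otimes> a = \<zero>}"
  by (auto simp: down_neg_def le_lneg_iff)

lemma join_eq_zero_iff:
  "\<lbrakk>x \<in> carrier A; y \<in> carrier A\<rbrakk> \<Longrightarrow> x \<oplus> y = \<zero> \<longleftrightarrow> x = \<zero> \<and> y = \<zero>"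
  using join_le_iff[of x y \<zero>] by (simp add: le_zero_iff join_closed point_closed)

text \<open>Annihilators are linear in \<open>a\<close>: \<open>x \<otimes> (a \<oplus> b)\<close>
  vanishes iff both \<open>x \<otimes> a\<close> and \<open>x \<otimes> b\<close> do, and
  \<open>x \<otimes> (a \<otimes> b)\<close> vanishes iff \<open>x \<otimes> a\<close> annihilates
  \<open>b\<close>. Only bijectivity remains as a condition.\<close>

lemma down_neg_iso_iff:
  "semimodule_iso A (self_semimodule A) (ideal_semimodule A) (down_neg A) \<longleftrightarrow>
    bij_betw (down_neg A) (carrier A) (join_ideals A)"
proof
  assume "semimodule_iso A (self_semimodule A) (ideal_semimodule A) (down_neg A)"
  then show "bij_betw (down_neg A) (carrier A) (join_ideals A)"
    using semimodule_iso.map_bij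
    by (fastforce simp: self_semimodule_def ideal_semimodule_def)
next
  assume "bij_betw (down_neg A) (carrier A) (join_ideals A)"
  then show "semimodule_iso A (self_semimodule A) (ideal_semimodule A) (down_neg A)"
    by (intro semimodule_iso.intro semimodule_iso_axioms.intro self_semimodule ideal_semimodule)
      (auto simp: self_semimodule_def ideal_semimodule_def down_neg_eq join_closed point_closed
        mult_distrib_left mult_zero_right join_eq_zero_iff m_assoc)
qed

lemma bij_down_neg_iff:
  assumes "finite (carrier A)"
  shows "bij_betw (down_neg A) (carrier A) (join_ideals A) \<longleftrightarrow>
    (\<forall>a \<in> carrier A. lneg A (rneg A a) = a \<and> rneg A (lneg A a) = a)"
proof
  assume bij: "bij_betw (down_neg A) (carrier A) (join_ideals A)"
  show "\<forall>a \<in> carrier A. lneg A (rneg A a) = a \<and> rneg A (lneg A a) = a"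
  proof (intro ballI conjI)
    fix a assume a: "a \<in> carrier A"
    \<comment> \<open>By the triple identity both arguments have the same \<open>lneg A\<close>, so
      injectivity will identify them.\<close>
    have "down_neg A (rneg A (lneg A a)) = down_neg A a"
      using a by (simp add: down_neg_def lneg_rneg_lneg)
    then show "rneg A (lneg A a) = a"
      using bij a lneg_closed rneg_closed unfolding bij_betw_def inj_on_def by blast
    \<comment> \<open>Surjectivity, applied to the principal ideal of \<open>a\<close>, exhibits
      \<open>a\<close> as a value of \<open>lneg A\<close>; such values are fixed by the triple
      identity.\<close>
    obtain b where b: "b \<in> carrier A" "down_neg A b = {x \<in> carrier A. x \<preceq> a}"
      using principal_join_ideal[OF a] unfolding bij_betw_imp_surj_on[OF bij, symmetric] by auto
    then have "lneg A b = a"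
      using a by (intro eq_if_same_lower_bounds) (auto simp: down_neg_def lneg_closed)
    then show "lneg A (rneg A a) = a"
      using b lneg_rneg_lneg by blast
  qed
next
  assume inv: "\<forall>a \<in> carrier A. lneg A (rneg A a) = a \<and> rneg A (lneg A a) = a"
  have "a = b" if "a \<in> carrier A" "b \<in> carrier A" "down_neg A a = down_neg A b" for a b
  proof -
    \<comment> \<open>The set \<open>down_neg A a\<close> determines its greatest element
      \<open>lneg A a\<close>, from which \<open>rneg A\<close> recovers \<open>a\<close>.\<close>
    have "lneg A a = lneg A b"
      using that by (intro eq_if_same_lower_bounds) (auto simp: down_neg_def lneg_closed)
    then show ?thesis
      using inv that by metis
  qed
  moreover have "down_neg A a \<in> join_ideals A" if "a \<in> carrier A" for a
    using principal_join_ideal lneg_closed that by (simp add: down_neg_def)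
  moreover have "I \<in> down_neg A ` carrier A" if "I \<in> join_ideals A" for I
  proof -
    \<comment> \<open>Finiteness enters here: \<open>I\<close> is principal, and
      \<open>rneg A m\<close> is a preimage since its \<open>lneg A\<close> is
      \<open>m\<close>.\<close>
    obtain m where "m \<in> carrier A" "I = {x \<in> carrier A. x \<preceq> m}"
      using finite_join_ideal_principal[OF assms \<open>I \<in> join_ideals A\<close>] by blast
    then show ?thesis
      using inv rneg_closed by (intro image_eqI[of _ _ "rneg A m"]) (auto simp: down_neg_def)
  qed
  ultimately show "bij_betw (down_neg A) (carrier A) (join_ideals A)"
    by (auto simp: bij_betw_def inj_on_def)
qed

end

theorem theorem10:
  fixes A :: "('a, 'm) residuated_scheme"
  assumes "pointed_residuated_join_semilattice A"
    and "finite (carrier A)"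
    and "one_bounded A"
    and "is_bottom A \<zero>\<^bsub>A\<^esub>"
  shows "involutive_semiring A (rneg A) (lneg A) \<longleftrightarrow>
    semimodule_iso A (self_semimodule A) (ideal_semimodule A) (down_neg A)"
proof -
  interpret bottom_pointed_residuated_join_semilattice A
    using assms(1,4)
    by (simp add: bottom_pointed_residuated_join_semilattice_def
        bottom_pointed_residuated_join_semilattice_axioms_def)
  show ?thesis
    using involutive_semiring_iff down_neg_iso_iff bij_down_neg_iff[OF assms(2)] by simp
qed

end
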